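(* Let $D$ be an rc-graph, let $r\ge 1$, and let $r\ge i_1>i_2>\dots>i_t>0$ and $k_1,\dots,k_t\ge 1$ be integers. Then the row insertion algorithm (described in the context), which inserts $k_s$ elements into row $i_s$ of $D$ for $s=1,\dots,t$ at level $r$, produces an rc-graph.
   Context: Graphs and strands. A graph is a finite subset of $\{1,2,\dots\}\times\{1,2,\dots\}$; its elements are called intersections, and $(i,j)$ denotes the position in row $i$ and column $j$ (rows numbered from top to bottom, columns from left to right). Strands are drawn as follows. For each $i$, strand $i$ enters from the left at position $(i,1)$. At a position which is an intersection, the strand entering from the left leaves on the right and the strand entering from below leaves at the top (the two strands cross). At a position which is not an intersection, the strand entering from the left leaves at the top and the strand entering from below leaves on the right (they do not cross). Thus strands move right and up; strand $i$ finally leaves through the top of some column $w(i)$, and $w$ is called the permutation of the graph. Strands are named by the row in which they start. An rc-graph is a graph in which no two strands cross more than once; it is then called an rc-graph for $w$. Row insertion algorithm. The input is an rc-graph $D$, a level $r$, and the data $r\ge i_1>\dots>i_t>0$, $k_1,\dots,k_t$. During the algorithm one maintains the current graph (initially $D$) and an ordered sequence of pairs $(a_1,b_1),(a_2,b_2),\dots$ (initially empty) with $a_1\le a_2\le\dots\le r$ and with the $b_i$ distinct and $>r$. A position that is not an intersection is called insertable if either (I1) the strand $s$ entering from the left and the strand $q$ entering from below satisfy $s\le r<q$ and $q\ne b_j$ for all $j$; or (I2) the strand entering from the left is some $b_i$ of the current sequence and the strand $q$ entering from below satisfies $r<q$ and $q\ne b_j$ for all $j$. Adding an intersection at an insertable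 position means adding it to the graph and updating the sequence: in case (I1) insert the pair $(s,q)$ into the sequence in the rightmost place for which the $a$'s remain nondecreasing; in case (I2) insert $(a_i,q)$ immediately before $(a_i,b_i)$. An intersection is called removable if the strand entering from the left is some $b_i$ of the current sequence and the strand entering from below is either (R1) $a_i$, or (R2) some $b_j$ of the current sequence with $a_j=a_i$. Removing it means deleting it from the graph and deleting the pair $(a_i,b_i)$ from the sequence. Inserting $k$ elements into a row means: $k$ times, find the rightmost insertable position of that row (with respect to the current graph and sequence) and add an intersection there. Rectifying a row $\ell$ means: starting from the left, look for a removable intersection in row $\ell$; if one is found at $(\ell,j)$, remove it, then find the maximal $j'<j$ such that $(\ell,j')$ is insertable and add an intersection there; then look to the right for another removable intersection in the row and treat it in the same way; continue until none is found. The algorithm starts in row $i_1$, inserting $k_1$ elements into it. It then proceeds upward through the rows $\ell=i_1-1,i_1-2,\dots,1$: in each row $\ell$ it first rectifies row $\ell$ and then, if $\ell=i_s$ for some $s$, inserts $k_s$ elements into row $\ell$. The output is the graph obtained after row $1$ has been treated. *)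

theory Defs
  imports Main
begin

type_synonym position = "nat \<times> nat"

definition graph :: "position set \<Rightarrow> bool" where
  "graph D \<longleftrightarrow> finite D \<and> D \<subseteq> {1..} \<times> {1..}"

text \<open>
  The names of the strands that enter position \<open>(i, j)\<close> from the left and from below; only
  positions with \<open>i, j \<ge> 1\<close> matter. What enters from the left in column \<open>j > 1\<close> is what leaves
  \<open>(i, j - 1)\<close> on the right, and what enters from below is what leaves \<open>(i + 1, j)\<close> at the top.
  The conjunct \<open>finite D\<close> only serves termination; it holds for every graph.
\<close>

function left_strand below_strand :: "position set \<Rightarrow> nat \<Rightarrow> nat \<Rightarrow> nat" where
  "left_strand D i j =
     (if j \<le> 1 then i
      else if (i, j - 1) \<in> D then left_strand D i (j - 1)
      else below_strand D i (j - 1))"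
| "below_strand D i j =
     (if finite D \<and> (i + 1, j) \<in> D then below_strand D (i + 1) j
      else left_strand D (i + 1) j)"
  by pat_completeness auto
termination
proof (relation "inv_image (less_than <*lex*> less_than <*lex*> less_than)
    (\<lambda>x. case x of
        Inl (D, i, j) \<Rightarrow> (j, 0 :: nat, 0)
      | Inr (D, i, j) \<Rightarrow> (j, 1, card {i'. i < i' \<and> (i', j) \<in> D}))", goal_cases)
  case (4 D i j)
  have "{i'. i < i' \<and> (i', j) \<in> D} \<subseteq> fst ` D"
    by force
  then have "finite {i'. i < i' \<and> (i', j) \<in> D}"
    using 4 by (meson finite_imageI finite_subset)
  moreover have "{i'. i + 1 < i' \<and> (i', j) \<in> D} \<subset> {i'. i < i' \<and> (i', j) \<in> D}"
    using 4 by auto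
  ultimately show ?case
    by (simp add: psubset_card_mono)
qed auto

declare left_strand.simps [simp del] below_strand.simps [simp del]

definition crossings :: "position set \<Rightarrow> nat \<Rightarrow> nat \<Rightarrow> position set" where
  "crossings D s q = {(i, j). (i, j) \<in> D \<and> {left_strand D i j, below_strand D i j} = {s, q}}"

definition rc_graph :: "position set \<Rightarrow> bool" where
  "rc_graph D \<longleftrightarrow> graph D \<and> (\<forall>s q. s \<noteq> q \<longrightarrow> card (crossings D s q) \<le> 1)"

text \<open>
  The current graph together with the current sequence \<open>(a\<^sub>1, b\<^sub>1), (a\<^sub>2, b\<^sub>2), \<dots>\<close>.
\<close>

type_synonym state = "position set \<times> (nat \<times> nat) list"

fun insertable :: "nat \<Rightarrow> state \<Rightarrow> position \<Rightarrow> bool" where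
  "insertable r (D, ps) (i, j) \<longleftrightarrow>
     1 \<le> i \<and> 1 \<le> j \<and> (i, j) \<notin> D \<and>
     (let s = left_strand D i j; q = below_strand D i j; bs = snd ` set ps in
        (s \<le> r \<and> r < q \<and> q \<notin> bs) \<or>
        (s \<in> bs \<and> r < q \<and> q \<notin> bs))"

text \<open>The rightmost place for \<open>(s, q)\<close> that keeps the first components nondecreasing.\<close>

definition insert_rightmost :: "nat \<Rightarrow> nat \<Rightarrow> (nat \<times> nat) list \<Rightarrow> (nat \<times> nat) list" where
  "insert_rightmost s q ps =
     takeWhile (\<lambda>(a, b). a \<le> s) ps @ (s, q) # dropWhile (\<lambda>(a, b). a \<le> s) ps"

fun insert_before :: "nat \<Rightarrow> nat \<Rightarrow> (nat \<times> nat) list \<Rightarrow> (nat \<times> nat) list" where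
  "insert_before s q [] = []"
| "insert_before s q ((a, b) # ps) =
     (if b = s then (a, q) # (a, b) # ps else (a, b) # insert_before s q ps)"

text \<open>
  At an insertable position the two cases are told apart by whether the strand from the left
  is at most \<open>r\<close>, because all \<open>b\<^sub>i\<close> exceed \<open>r\<close>.
\<close>

fun add_intersection :: "nat \<Rightarrow> position \<Rightarrow> state \<Rightarrow> state" where
  "add_intersection r (i, j) (D, ps) =
     (let s = left_strand D i j; q = below_strand D i j in
        (insert (i, j) D,
         if s \<le> r then insert_rightmost s q ps else insert_before s q ps))"

fun removable :: "state \<Rightarrow> position \<Rightarrow> bool" where
  "removable (D, ps) (i, j) \<longleftrightarrow>
     (i, j) \<in> D \<and>
     (\<exists>(a, b) \<in> set ps. left_strand D i j = b \<and>
        (below_strand D i j = a \<or> (\<exists>(a', b') \<in> set ps. a' = a \<and> below_strand D i j = b')))"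

fun remove_intersection :: "position \<Rightarrow> state \<Rightarrow> state" where
  "remove_intersection (i, j) (D, ps) =
     (D - {(i, j)}, filter (\<lambda>(a, b). b \<noteq> left_strand D i j) ps)"

text \<open>
  Add an intersection at the rightmost insertable position of row \<open>l\<close> whose column lies in \<open>C\<close>.
  The result is \<open>None\<close> if the algorithm is stuck, that is, if no rightmost such position exists.
\<close>

definition add_in_row :: "nat \<Rightarrow> nat \<Rightarrow> nat set \<Rightarrow> state \<Rightarrow> state option" where
  "add_in_row r l C st =
     (let J = {j \<in> C. insertable r st (l, j)} in
        if finite J \<and> J \<noteq> {} then Some (add_intersection r (l, Max J) st) else None)"

primrec insert_elements :: "nat \<Rightarrow> nat \<Rightarrow> nat \<Rightarrow> state \<Rightarrow> state option" where
  "insert_elements r l 0 st = Some st"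
| "insert_elements r l (Suc k) st =
     Option.bind (add_in_row r l UNIV st) (insert_elements r l k)"

text \<open>
  The part of the rectification of row \<open>l\<close> that takes place to the right of column \<open>c\<close>. The
  result is \<open>None\<close> if the algorithm is stuck or does not terminate.
\<close>

partial_function (option) rectify_from :: "nat \<Rightarrow> nat \<Rightarrow> nat \<Rightarrow> state \<Rightarrow> state option" where
  "rectify_from r l c st =
     (if \<exists>j>c. removable st (l, j)
      then let j = (LEAST j. c < j \<and> removable st (l, j)) in
        Option.bind (add_in_row r l {..<j} (remove_intersection (l, j) st)) (rectify_from r l j)
      else Some st)"

definition rectify :: "nat \<Rightarrow> nat \<Rightarrow> state \<Rightarrow> state option" where
  "rectify r l = rectify_from r l 0"

text \<open>
  The list \<open>ins\<close> consists of the pairs \<open>(i\<^sub>1, k\<^sub>1), \<dots>, (i\<^sub>t, k\<^sub>t)\<close>. The function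
  \<open>process_rows\<close> treats the rows \<open>n, n - 1, \<dots>, 1\<close> in this order.
\<close>

primrec process_rows :: "nat \<Rightarrow> (nat \<times> nat) list \<Rightarrow> nat \<Rightarrow> state \<Rightarrow> state option" where
  "process_rows r ins 0 st = Some st"
| "process_rows r ins (Suc n) st =
     Option.bind (rectify r (Suc n) st) (\<lambda>st1.
     Option.bind
       (case map_of ins (Suc n) of
          None \<Rightarrow> Some st1
        | Some k \<Rightarrow> insert_elements r (Suc n) k st1)
       (process_rows r ins n))"

fun row_insertion :: "nat \<Rightarrow> (nat \<times> nat) list \<Rightarrow> position set \<Rightarrow> position set option" where
  "row_insertion r [] D = Some D"
| "row_insertion r ((i, k) # ins) D =
     map_option fst
       (Option.bind (insert_elements r i k (D, [])) (process_rows r ins (i - 1)))"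

end

theory Submission
  imports Defs "HOL-Combinatorics.Transposition"
begin

text \<open>
  The original graph \<open>D\<close> and the current graph \<open>E\<close> are compared along one and the same frontier: a
  lattice path that separates the positions already treated (the rows below \<open>l\<close> and the first \<open>c\<close>
  columns of row \<open>l\<close>) from the others. Reading the strands that cross the frontier from north-west
  to south-east gives a permutation of the natural numbers, called \<open>u\<close> for \<open>D\<close> and \<open>v\<close> for \<open>E\<close>. An
  intersection multiplies such a word by an adjacent transposition of places, and a graph is an
  rc-graph iff each intersection acts on an ascent of the current word, that is, iff the strand
  from the left is smaller than the strand from below (\<open>rc_graph_if_reduced\<close> and
  \<open>rc_graph_reduced\<close>, both from the description of the inversions in \<open>inversions_swept\<close>).

  The order in which the algorithm keeps its pairs \<open>(a, b)\<close> is irrelevant; only their set \<open>P\<close>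
  matters. Let the class of \<open>a\<close> consist of \<open>a\<close> and of all \<open>b\<close> with \<open>(a, b) \<in> P\<close>. The invariant
  \<open>linked_words\<close> says that at each place the entries of \<open>u\<close> and \<open>v\<close> belong to the same class, and
  that each \<open>b\<close> of a pair \<open>(a, b)\<close> occurs in \<open>v\<close> strictly to the left of its place in \<open>u\<close>, with no
  entry of \<open>u\<close> or \<open>v\<close> in the interval from \<open>a\<close> to \<open>b\<close>, and no member of the class of \<open>a\<close>, strictly
  between these two places. Thus a class with places \<open>p\<^sub>0 < \<dots> < p\<^sub>m\<close> reads \<open>a, b\<^sub>1, \<dots>, b\<^sub>m\<close> in \<open>u\<close> and
  \<open>b\<^sub>1, \<dots>, b\<^sub>m, a\<close> in \<open>v\<close>; this is a chain of covers in the Bruhat order.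

  Three facts on words carry the proof. If \<open>D\<close> has an intersection at the next position and it is
  not removable in \<open>E\<close>, then it acts on an ascent of \<open>v\<close> and the invariant persists
  (\<open>keep_crossing\<close>). If it is removable, the invariant holds after the intersection and its pair
  have been removed from \<open>E\<close> (\<open>remove_link\<close>). Adding an intersection at an insertable position of
  row \<open>l\<close> exchanges in \<open>v\<close> two values between which all entries are larger than the second one;
  then the exchange is automatically an ascent and the invariant holds with the new pair
  (\<open>insert_link\<close>). The algorithm is never stuck: strand \<open>l \<le> r\<close> enters row \<open>l\<close>, so that somewhere
  between column \<open>1\<close> and a column entered from the left by an unpaired strand larger than \<open>r\<close>
  there is an insertable position (\<open>insertable_exists\<close>).
\<close>

section \<open>Words linked by a set of pairs\<close>

text \<open>
  The class of a value, represented by its smallest member: the partner \<open>a\<close> of \<open>x\<close> if there is a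
  pair \<open>(a, x)\<close>, and \<open>x\<close> itself otherwise. The partner is unique in all uses.
\<close>

definition root :: "(nat \<times> nat) set \<Rightarrow> nat \<Rightarrow> nat" where
  "root P x = (if x \<in> snd ` P then THE a. (a, x) \<in> P else x)"

text \<open>
  The relation between the word \<open>u\<close> of the original graph and the word \<open>v\<close> of the current graph
  along a common frontier. Both are functions from places to values. The assumption \<open>link\<close> starts
  from the place \<open>x\<close> of a paired value in \<open>v\<close> and yields its place \<open>y\<close> in \<open>u\<close>.
\<close>

locale linked_words =
  fixes r :: nat and P :: "(nat \<times> nat) set" and u v :: "nat \<Rightarrow> nat"
  assumes bij_u: "bij u" and bij_v: "bij v"
    and finite_pairs: "finite P"
    and pair_le: "(a, b) \<in> P \<Longrightarrow> a \<le> r"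
    and pair_gt: "(a, b) \<in> P \<Longrightarrow> r < b"
    and pair_unique: "(a, b) \<in> P \<Longrightarrow> (a', b) \<in> P \<Longrightarrow> a = a'"
    and same_root: "root P (u x) = root P (v x)"
    and link: "(a, v x) \<in> P \<Longrightarrow> \<exists>y>x. u y = v x \<and>
      (\<forall>z. x < z \<longrightarrow> z < y \<longrightarrow> u z \<notin> {a..v x} \<and> v z \<notin> {a..v x} \<and> root P (v z) \<noteq> a)"
begin

lemma root_eq_iff: "root P x = a \<longleftrightarrow> (a, x) \<in> P \<or> (x = a \<and> x \<notin> snd ` P)"
proof (cases "x \<in> snd ` P")
  case True
  then obtain c where c: "(c, x) \<in> P" by auto
  then have "(THE a. (a, x) \<in> P) = c"
    using pair_unique by blast
  then show ?thesis
    using True c pair_unique by (auto simp: root_def)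
qed (force simp: root_def)

lemma in_snd: "(a, b) \<in> P \<Longrightarrow> b \<in> snd ` P"
  by force

lemma root_pair: "(a, b) \<in> P \<Longrightarrow> root P b = a"
  by (simp add: root_eq_iff)

lemma root_gt: "r < root P x \<Longrightarrow> root P x = x"
  using root_eq_iff[of x "root P x"] pair_le[of "root P x" x] by auto

lemma root_small: "x \<le> r \<Longrightarrow> root P x = x"
  by (auto simp: root_eq_iff dest: pair_gt)

lemma inj_words: "u x = u y \<longleftrightarrow> x = y" "v x = v y \<longleftrightarrow> x = y"
  using bij_u bij_v by (auto dest: bij_is_inj injD)

text \<open>
  The assumption \<open>link\<close>, read from the place of the paired value in \<open>u\<close>.
\<close>

lemma link_back:
  assumes "(a, u y) \<in> P"
  obtains x where "x < y" "v x = u y"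
    "\<And>z. x < z \<Longrightarrow> z < y \<Longrightarrow> u z \<notin> {a..u y} \<and> v z \<notin> {a..u y} \<and> root P (v z) \<noteq> a"
proof -
  obtain x where x: "v x = u y"
    using bij_v by (metis bij_pointE)
  then obtain y' where "y' > x" "u y' = v x" and
    between: "\<And>z. x < z \<Longrightarrow> z < y' \<Longrightarrow> u z \<notin> {a..v x} \<and> v z \<notin> {a..v x} \<and> root P (v z) \<noteq> a"
    using link[of a x] assms by auto
  moreover from this have "y' = y"
    using x inj_words by simp
  ultimately show ?thesis
    using that x by metis
qed

text \<open>
  The links of a class lead to the right, and only its smallest member is not the start of a link;
  hence this member occupies the rightmost place of the class in \<open>v\<close>.
\<close>

lemma root_is_last:
  assumes "v x = a" "a \<le> r" "root P (v y) = a"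
  shows "y \<le> x"
proof -
  let ?M = "{y. root P (v y) = a}"
  have "?M \<subseteq> v -` (insert a (snd ` P))"
    by (auto simp: root_eq_iff dest: in_snd)
  then have fin: "finite ?M"
    using finite_pairs bij_v by (meson bij_is_inj finite.insertI finite_imageI finite_subset finite_vimageI)
  define m where "m = Max ?M"
  have m: "root P (v m) = a"
    using Max_in[OF fin] assms(3) unfolding m_def by auto
  have "(a, v m) \<notin> P"
  proof
    assume "(a, v m) \<in> P"
    then obtain z where "z > m" "u z = v m"
      using link by blast
    then have "z \<in> ?M"
      using m same_root[of z] by simp
    then show False
      using \<open>z > m\<close> Max_ge[OF fin, of z] unfolding m_def by linarith
  qed
  then have "v m = a"
    using m by (simp add: root_eq_iff)
  then have "m = x"
    using assms(1) inj_words(2)[of m x] by simp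
  then show ?thesis
    using assms(3) Max_ge[OF fin, of y] unfolding m_def by simp
qed

text \<open>
  The effect of a new intersection between the strands \<open>s = v x\<close> and \<open>q = v y\<close>. Both kinds of
  insertable positions are covered: the new pair is \<open>(s, q)\<close> if \<open>s \<le> r\<close>, and \<open>(a, q)\<close> if \<open>s\<close> is the
  larger member of the pair \<open>(a, s)\<close>. That \<open>s < q\<close> is part of the conclusion.
\<close>

lemma insert_link:
  assumes "x < y" and s: "v x \<le> r \<or> v x \<in> snd ` P" and q: "r < v y" "v y \<notin> snd ` P"
    and above: "\<And>z. x < z \<Longrightarrow> z < y \<Longrightarrow> v y < v z"
  shows "v x < v y"
    and "linked_words r (insert (root P (v x), v y) P) u (v \<circ> transpose x y)"
proof -
  have "root P (v y) = v y"
    using q by (simp add: root_eq_iff)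
  then have uy: "u y = v y"
    using same_root[of y] q root_gt[of "u y"] by simp
  \<comment> \<open>A link starting in \<open>[x, y)\<close> at a value above \<open>v y\<close> cannot jump over place \<open>y\<close>, so that it
    leads to another such start further right, and so on without end,
    which is impossible.\<close>
  have no_big: "False" if "x \<le> z" "z < y" "(a, v z) \<in> P" "v y < v z" for z a
    using that
  proof (induction "y - z" arbitrary: z rule: less_induct)
    case less
    obtain z' where z': "z < z'" "u z' = v z"
      "\<And>t. z < t \<Longrightarrow> t < z' \<Longrightarrow> v t \<notin> {a..v z}"
      using link[OF less.prems(3)] by metis
    have "a \<le> v y"
      using pair_le[OF less.prems(3)] q by simp
    have "z' \<noteq> y"
      using uy z'(2) q(2) less.prems(3) by force
    moreover have "\<not> y < z'"
      using z'(3)[of y] less.prems \<open>a \<le> v y\<close> by auto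
    ultimately have "z' < y" by simp
    have "v y < v z'"
      using above z'(1) less.prems \<open>z' < y\<close> by simp
    moreover have "root P (v z') = a"
      using same_root[of z'] z'(2) root_pair[OF less.prems(3)] by simp
    ultimately have "(a, v z') \<in> P"
      using \<open>a \<le> v y\<close> by (auto simp: root_eq_iff)
    moreover have "y - z' < y - z" "x \<le> z'"
      using z'(1) less.prems by auto
    ultimately show False
      using less.hyps[of z'] \<open>z' < y\<close> \<open>v y < v z'\<close> by blast
  qed
  have fixed: "u z = v z \<and> v z \<notin> snd ` P" if "x < z" "z < y" for z
  proof -
    have *: "v z \<notin> snd ` P"
      using no_big[of z] above[of z] that by fastforce
    then have "root P (v z) = v z"
      by (simp add: root_eq_iff)
    moreover have "v z > r"
      using above that q by force
    ultimately show ?thesis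
      using same_root[of z] root_gt[of "u z"] * by simp
  qed
  have "v x \<noteq> v y"
    using \<open>x < y\<close> inj_words by simp
  then show less: "v x < v y"
    using s no_big[of x] \<open>x < y\<close> q by fastforce
  define a where "a = root P (v x)"
  let ?P = "insert (a, v y) P"
  define v' where "v' = v \<circ> transpose x y"
  have "a \<le> r"
    using s root_small[of "v x"] root_pair pair_le unfolding a_def by auto
  have vals: "v' x = v y" "v' y = v x" "\<And>z. z \<noteq> x \<Longrightarrow> z \<noteq> y \<Longrightarrow> v' z = v z"
    by (auto simp: v'_def transpose_def)
  have new_unique: "c = c'" if "(c, b) \<in> ?P" "(c', b) \<in> ?P" for c c' b
    using that q(2) by (metis insert_iff prod.inject in_snd pair_unique)
  have "(THE c. (c, v y) \<in> ?P) = a"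
    by (rule the_equality, simp, rule new_unique, assumption, simp)
  then have root_q: "root ?P (v y) = a"
    by (simp add: root_def)
  have root_old: "root ?P c = root P c" if "c \<noteq> v y" for c
    using that by (simp add: root_def)
  have "linked_words r ?P u v'"
  proof
    show "bij u" by (rule bij_u)
    show "bij v'" using bij_v by (simp add: v'_def bij_comp)
    show "finite ?P" using finite_pairs by simp
    show "c \<le> r" if "(c, b) \<in> ?P" for c b
      using that pair_le[of c b] \<open>a \<le> r\<close> by auto
    show "r < b" if "(c, b) \<in> ?P" for c b
      using that pair_gt[of c b] q by auto
    show "c = c'" if "(c, b) \<in> ?P" "(c', b) \<in> ?P" for c c' b
      using new_unique that .
    show "root ?P (u z) = root ?P (v' z)" for z
    proof -
      consider "z = x" | "z = y" | "z \<noteq> x" "z \<noteq> y" by blast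
      then show ?thesis
      proof cases
        case 1
        have "u x \<noteq> v y" using uy inj_words \<open>x < y\<close> by (metis less_irrefl)
        then show ?thesis using 1 vals root_q root_old same_root[of x] a_def by simp
      next
        case 2
        then show ?thesis using vals root_q root_old[OF \<open>v x \<noteq> v y\<close>] a_def uy by simp
      next
        case 3
        then have "u z \<noteq> v y" "v z \<noteq> v y" using uy inj_words by metis+
        then show ?thesis using 3 vals root_old same_root[of z] by simp
      qed
    qed
    show "\<exists>w>z. u w = v' z \<and> (\<forall>t. z < t \<longrightarrow> t < w \<longrightarrow>
        u t \<notin> {c..v' z} \<and> v' t \<notin> {c..v' z} \<and> root ?P (v' t) \<noteq> c)"
      if c: "(c, v' z) \<in> ?P" for c z
    proof -
      consider "z = x" | "z = y" | "z \<noteq> x" "z \<noteq> y" by blast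
      then show ?thesis
      proof cases
        case 1
        then have "c = a"
          using c vals q(2) by force
        have "u t \<notin> {c..v' z} \<and> v' t \<notin> {c..v' z} \<and> root ?P (v' t) \<noteq> c" if "z < t" "t < y" for t
        proof -
          have t: "u t = v t" "v t \<notin> snd ` P" "v' t = v t" "v y < v t"
            using fixed[of t] that 1 above vals(3)[of t] by auto
          then have "root ?P (v t) = v t"
            using root_old[of "v t"] by (simp add: root_eq_iff)
          then show ?thesis
            using t 1 vals q \<open>c = a\<close> \<open>a \<le> r\<close> by simp
        qed
        then show ?thesis
          using 1 vals(1) uy \<open>x < y\<close> by (intro exI[of _ y]) auto
      next
        case 2
        then have "(c, v x) \<in> P"
          using c vals \<open>v x \<noteq> v y\<close> by simp
        then obtain w where w: "w > x" "u w = v x" and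
          between: "\<And>t. x < t \<Longrightarrow> t < w \<Longrightarrow> u t \<notin> {c..v x} \<and> v t \<notin> {c..v x} \<and> root P (v t) \<noteq> c"
          using link by metis
        have "w \<noteq> y" using w uy \<open>v x \<noteq> v y\<close> by auto
        moreover have "\<not> w < y"
          using fixed[of w] w \<open>(c, v x) \<in> P\<close> by force
        ultimately have "y < w" by simp
        moreover have "u t \<notin> {c..v' z} \<and> v' t \<notin> {c..v' z} \<and> root ?P (v' t) \<noteq> c" if "z < t" "t < w" for t
        proof -
          have "v' t = v t" "v t \<noteq> v y" using that 2 \<open>x < y\<close> inj_words vals(3)[of t] by auto
          then show ?thesis
            using between[of t] that 2 vals \<open>x < y\<close> root_old by simp
        qed
        ultimately show ?thesis
          using w 2 vals(2) by (intro exI[of _ w]) auto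
      next
        case 3
        then have "(c, v z) \<in> P"
          using c vals inj_words by auto
        then obtain w where w: "w > z" "u w = v z" and
          between: "\<And>t. z < t \<Longrightarrow> t < w \<Longrightarrow> u t \<notin> {c..v z} \<and> v t \<notin> {c..v z} \<and> root P (v t) \<noteq> c"
          using link by metis
        have out: "\<not> (x < w \<and> w \<le> y)" "\<not> (x \<le> z \<and> z \<le> y)"
          using fixed[of w] fixed[of z] w \<open>(c, v z) \<in> P\<close> uy q(2) 3
          by (force simp: le_less)+
        have "u t \<notin> {c..v' z} \<and> v' t \<notin> {c..v' z} \<and> root ?P (v' t) \<noteq> c" if t: "z < t" "t < w" for t
        proof -
          consider "t = x" | "t = y" | "t \<noteq> x" "t \<noteq> y" by blast
          then show ?thesis
          proof cases
            case 1
            then show ?thesis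
              using between[of x] between[of y] t 3 vals root_q out \<open>x < y\<close> a_def by force
          next
            case 2
            then show ?thesis
              using between[of x] between[of y] t 3 vals root_old[OF \<open>v x \<noteq> v y\<close>] out \<open>x < y\<close> by force
          next
            case no: 3
            then show ?thesis
              using between[of t] t 3 vals root_old[of "v t"] inj_words by auto
          qed
        qed
        then show ?thesis
          using w vals(3)[OF 3] by (intro exI[of _ w]) auto
      qed
    qed
  qed
  then show "linked_words r (insert (root P (v x), v y) P) u (v \<circ> transpose x y)"
    unfolding a_def v'_def .
qed

text \<open>
  A removable intersection occurs where a link is about to join the neighbouring places \<open>x\<close> and
  \<open>Suc x\<close>. When it is kept in the original graph only, its pair becomes superfluous.
\<close>

lemma remove_link:
  assumes b: "(a, v x) \<in> P" and root: "root P (v (Suc x)) = a" and ascent: "u x < u (Suc x)"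
  shows "u (Suc x) = v x"
    and "linked_words r (P - {(a, v x)}) (u \<circ> transpose x (Suc x)) v"
proof -
  obtain y where y: "x < y" "u y = v x" "\<And>z. x < z \<Longrightarrow> z < y \<Longrightarrow> root P (v z) \<noteq> a"
    using link[OF b] by metis
  then have "y = Suc x"
    using root y(3)[of "Suc x"] by force
  then show ux: "u (Suc x) = v x"
    using y by simp
  let ?P = "P - {(a, v x)}"
  define u' where "u' = u \<circ> transpose x (Suc x)"
  have vals: "u' x = v x" "u' (Suc x) = u x" "\<And>z. z \<noteq> x \<Longrightarrow> z \<noteq> Suc x \<Longrightarrow> u' z = u z"
    using ux by (auto simp: u'_def transpose_def)
  have gone: "v x \<notin> snd ` ?P"
    using b pair_unique by fastforce
  have root_b: "root ?P (v x) = v x"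
    using gone by (simp add: root_def)
  have root_old: "root ?P c = root P c" if "c \<noteq> v x" for c
  proof -
    have "c \<in> snd ` ?P \<longleftrightarrow> c \<in> snd ` P" "\<And>d. (d, c) \<in> ?P \<longleftrightarrow> (d, c) \<in> P"
      using that by force+
    then show ?thesis
      by (simp add: root_def)
  qed
  have "linked_words r ?P u' v"
  proof
    show "bij u'" using bij_u by (simp add: u'_def bij_comp)
    show "bij v" by (rule bij_v)
    show "finite ?P" using finite_pairs by simp
    show "c \<le> r" if "(c, b) \<in> ?P" for c b
      using that pair_le[of c b] by simp
    show "r < b" if "(c, b) \<in> ?P" for c b
      using that pair_gt[of c b] by simp
    show "c = c'" if "(c, b) \<in> ?P" "(c', b) \<in> ?P" for c c' b
      using that pair_unique[of c b c'] by simp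
    show "root ?P (u' z) = root ?P (v z)" for z
    proof -
      consider "z = x" | "z = Suc x" | "z \<noteq> x" "z \<noteq> Suc x" by blast
      then show ?thesis
      proof cases
        case 1
        then show ?thesis using vals by simp
      next
        case 2
        have "root P (u x) = a" using same_root[of x] root_pair[OF b] by simp
        moreover have "u x \<noteq> v x" "v (Suc x) \<noteq> v x" using ux inj_words by (metis n_not_Suc_n)+
        ultimately show ?thesis using 2 vals root root_old by simp
      next
        case 3
        then have "u z \<noteq> v x" "v z \<noteq> v x" using ux inj_words by metis+
        then show ?thesis using 3 vals root_old same_root[of z] by simp
      qed
    qed
    show "\<exists>w>z. u' w = v z \<and> (\<forall>t. z < t \<longrightarrow> t < w \<longrightarrow>
        u' t \<notin> {c..v z} \<and> v t \<notin> {c..v z} \<and> root ?P (v t) \<noteq> c)"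
      if c: "(c, v z) \<in> ?P" for c z
    proof -
      have "z \<noteq> x" using c gone by force
      have "c \<noteq> v x" using c pair_le pair_gt[OF b] by force
      obtain w where w: "w > z" "u w = v z" and
        between: "\<And>t. z < t \<Longrightarrow> t < w \<Longrightarrow> u t \<notin> {c..v z} \<and> v t \<notin> {c..v z} \<and> root P (v t) \<noteq> c"
        using link c by (metis DiffD1)
      have roots: "root ?P (v t) \<noteq> c" if "root P (v t) \<noteq> c" for t
        using that root_old root_b \<open>c \<noteq> v x\<close> by metis
      have "w \<noteq> Suc x" using w ux \<open>z \<noteq> x\<close> inj_words by metis
      show ?thesis
      proof (cases "w = x")
        case True
        have "u' t \<notin> {c..v z} \<and> v t \<notin> {c..v z} \<and> root ?P (v t) \<noteq> c" if "z < t" "t < Suc x" for t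
        proof (cases "t = x")
          case t: True
          have "v z < v x" using ascent ux w True by simp
          then show ?thesis using t vals root_b \<open>c \<noteq> v x\<close> by simp
        next
          case False
          then show ?thesis using that between[of t] True vals roots by simp
        qed
        then show ?thesis
          using True w vals by (intro exI[of _ "Suc x"]) auto
      next
        case False
        have "u' t \<notin> {c..v z} \<and> v t \<notin> {c..v z} \<and> root ?P (v t) \<noteq> c" if t: "z < t" "t < w" for t
        proof -
          have "z < transpose x (Suc x) t \<and> transpose x (Suc x) t < w"
            using t w False \<open>w \<noteq> Suc x\<close> \<open>z \<noteq> x\<close> unfolding transpose_def by auto
          then show ?thesis
            unfolding u'_def
            using between[of t] between[of "transpose x (Suc x) t"] t roots by simp
        qed
        then show ?thesis
          using w vals False \<open>w \<noteq> Suc x\<close> by (intro exI[of _ w]) auto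
      qed
    qed
  qed
  then show "linked_words r (P - {(a, v x)}) (u \<circ> transpose x (Suc x)) v"
    unfolding u'_def .
qed

text \<open>
  An intersection of both graphs that is not removable.
\<close>

lemma keep_crossing:
  assumes ascent: "u x < u (Suc x)"
    and keep: "\<And>a. (a, v x) \<in> P \<Longrightarrow> root P (v (Suc x)) \<noteq> a"
  shows "v x < v (Suc x)"
    and "linked_words r P (u \<circ> transpose x (Suc x)) (v \<circ> transpose x (Suc x))"
proof -
  have not_adjacent: "v x \<noteq> u (Suc x)" if "(a, v x) \<in> P" for a
    using keep[OF that] same_root[of "Suc x"] root_pair[OF that] by metis
  \<comment> \<open>A link that starts at \<open>x\<close> passes over \<open>Suc x\<close>, and one that ends at \<open>Suc x\<close> passes over \<open>x\<close>.\<close>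
  have from_left: "u (Suc x) \<notin> {a..v x} \<and> v (Suc x) \<notin> {a..v x}" if b: "(a, v x) \<in> P" for a
  proof -
    obtain y where y: "x < y" "u y = v x"
      "\<And>z. x < z \<Longrightarrow> z < y \<Longrightarrow> u z \<notin> {a..v x} \<and> v z \<notin> {a..v x} \<and> root P (v z) \<noteq> a"
      using link[OF b] by metis
    then have "y \<noteq> Suc x"
      using not_adjacent[OF b] by auto
    then show ?thesis
      using y(1) y(3)[of "Suc x"] by simp
  qed
  have to_right: "u x < a \<and> v x \<notin> {a..u (Suc x)}" if b: "(a, u (Suc x)) \<in> P" for a
  proof -
    obtain p where p: "p < Suc x" "v p = u (Suc x)"
      "\<And>z. p < z \<Longrightarrow> z < Suc x \<Longrightarrow>
        u z \<notin> {a..u (Suc x)} \<and> v z \<notin> {a..u (Suc x)} \<and> root P (v z) \<noteq> a"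
      using link_back[OF b] by blast
    then have "p \<noteq> x"
      using not_adjacent b by metis
    then show ?thesis
      using p(1) p(3)[of x] ascent by auto
  qed
  \<comment> \<open>The links that become longer are those that start at \<open>Suc x\<close> and those that end at \<open>x\<close>; each
    gains one place, whose entries are shown to be harmless.\<close>
  have right_moved: "u x < a \<and> v x = u x \<and> root P (v x) \<noteq> a" if b: "(a, v (Suc x)) \<in> P" for a
  proof -
    have root_d: "root P (u (Suc x)) = a"
      using same_root root_pair[OF b] by simp
    have "a \<le> r"
      using pair_le[OF b] .
    have other: "root P (v x) \<noteq> a"
    proof
      assume a: "root P (v x) = a"
      then have "v x = a"
        using keep[of a] root_pair[OF b] by (auto simp: root_eq_iff)
      then show False
        using root_is_last[of x a "Suc x"] \<open>a \<le> r\<close> root_pair[OF b] by simp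
    qed
    have less: "u x < a"
      using root_d to_right[of a] ascent by (auto simp: root_eq_iff)
    have root_c: "root P (v x) = u x"
      using same_root[of x] root_small[of "u x"] less \<open>a \<le> r\<close> by simp
    have "(u x, v x) \<notin> P"
    proof
      assume c: "(u x, v x) \<in> P"
      then have "v x < u (Suc x)"
        using from_left[OF c] ascent by simp
      moreover have "r < v x"
        using pair_gt[OF c] .
      ultimately have "(a, u (Suc x)) \<in> P"
        using root_d \<open>a \<le> r\<close> by (auto simp: root_eq_iff)
      then show False
        using to_right[of a] \<open>v x < u (Suc x)\<close> \<open>r < v x\<close> \<open>a \<le> r\<close> by simp
    qed
    then show ?thesis
      using other less root_c by (auto simp: root_eq_iff dest: in_snd)
  qed
  have left_moved: "v (Suc x) = u (Suc x) \<and> root P (v (Suc x)) \<noteq> a \<and> v x < v (Suc x)"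
    if b: "(a, u x) \<in> P" for a
  proof -
    have ar: "a \<le> r" "r < u x"
      using pair_le[OF b] pair_gt[OF b] by auto
    have root_c: "root P (v x) = a"
      using same_root[of x] root_pair[OF b] by simp
    have other: "root P (v (Suc x)) \<noteq> a"
    proof
      assume a: "root P (v (Suc x)) = a"
      then have "v x = a"
        using keep[of a] root_c by (auto simp: root_eq_iff)
      then show False
        using root_is_last[of x a "Suc x"] ar a by simp
    qed
    have "(c, u (Suc x)) \<notin> P" for c
      using to_right[of c] ar pair_le[of c "u (Suc x)"] by auto
    then have "root P (u (Suc x)) = u (Suc x)"
      by (auto simp: root_eq_iff)
    then have eq: "v (Suc x) = u (Suc x)"
      using same_root[of "Suc x"] root_gt[of "v (Suc x)"] ar ascent by simp
    have "v x = a \<or> (a, v x) \<in> P"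
      using root_c by (auto simp: root_eq_iff)
    then have "v x < u (Suc x)"
      using from_left[of a] ar ascent by auto
    then show ?thesis
      using eq other by simp
  qed
  show "v x < v (Suc x)"
  proof -
    consider a where "(a, v (Suc x)) \<in> P" | a where "(a, u x) \<in> P"
      | "\<And>a. (a, v (Suc x)) \<notin> P" "\<And>a. (a, u x) \<notin> P" by blast
    then show ?thesis
    proof cases
      case (1 a)
      then show ?thesis
        using right_moved[OF 1] pair_le[OF 1] pair_gt[OF 1] by simp
    next
      case (2 a)
      then show ?thesis
        using left_moved[OF 2] by simp
    next
      case 3
      have c: "root P (v x) = u x"
        using 3(2) same_root[of x] root_eq_iff[of "u x" "u x"] by auto
      have d: "root P (u (Suc x)) = v (Suc x)"
        using 3(1) same_root[of "Suc x"] root_eq_iff[of "v (Suc x)" "v (Suc x)"] by auto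
      from c consider "(u x, v x) \<in> P" | "v x = u x"
        by (auto simp: root_eq_iff)
      then show ?thesis
      proof cases
        case 1
        then show ?thesis
          using from_left[OF 1] d ascent to_right[of "v (Suc x)"] by (auto simp: root_eq_iff)
      next
        case 2
        then show ?thesis
          using d ascent to_right[of "v (Suc x)"] by (auto simp: root_eq_iff)
      qed
    qed
  qed
  let ?t = "transpose x (Suc x)"
  show "linked_words r P (u \<circ> ?t) (v \<circ> ?t)"
  proof
    show "bij (u \<circ> ?t)" "bij (v \<circ> ?t)"
      using bij_u bij_v by (simp_all add: bij_comp)
    show "finite P" by (rule finite_pairs)
    show "c \<le> r" if "(c, b) \<in> P" for c b
      using that by (rule pair_le)
    show "r < b" if "(c, b) \<in> P" for c b
      using that by (rule pair_gt)
    show "c = c'" if "(c, b) \<in> P" "(c', b) \<in> P" for c c' b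
      using that by (rule pair_unique)
    show "root P ((u \<circ> ?t) z) = root P ((v \<circ> ?t) z)" for z
      using same_root by simp
    show "\<exists>w>z. (u \<circ> ?t) w = (v \<circ> ?t) z \<and> (\<forall>s. z < s \<longrightarrow> s < w \<longrightarrow>
        (u \<circ> ?t) s \<notin> {c..(v \<circ> ?t) z} \<and> (v \<circ> ?t) s \<notin> {c..(v \<circ> ?t) z} \<and> root P ((v \<circ> ?t) s) \<noteq> c)"
      if c: "(c, (v \<circ> ?t) z) \<in> P" for c z
    proof -
      define b where "b = v (?t z)"
      have cb: "(c, b) \<in> P" "c \<le> r" "r < b" "(c, v (?t z)) \<in> P"
        using c pair_le pair_gt unfolding b_def by auto
      obtain y where y: "y > ?t z" "u y = b"
        and between: "\<And>s. ?t z < s \<Longrightarrow> s < y \<Longrightarrow> u s \<notin> {c..b} \<and> v s \<notin> {c..b} \<and> root P (v s) \<noteq> c"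
        using link[of c "?t z"] cb(1) unfolding b_def by metis
      have "\<not> (?t z = x \<and> y = Suc x)"
        using not_adjacent[of c] y(2) cb(1) unfolding b_def by metis
      then have "z < ?t y"
        using y(1) unfolding transpose_def by (auto split: if_splits)
      moreover have "u (?t s) \<notin> {c..b} \<and> v (?t s) \<notin> {c..b} \<and> root P (v (?t s)) \<noteq> c"
        if s: "z < s" "s < ?t y" for s
      proof -
        have "?t z < ?t s \<and> ?t s < y \<or> z = x \<and> s = Suc x \<or> y = x \<and> s = x"
          using s y(1) unfolding transpose_def by (auto split: if_splits)
        then consider "?t z < ?t s" "?t s < y" | "z = x" "s = Suc x" | "y = x" "s = x"
          by blast
        then show ?thesis
        proof cases
          case 1
          then show ?thesis using between by blast
        next
          case 2
          then show ?thesis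
            using right_moved[of c] cb unfolding b_def by auto
        next
          case 3
          then show ?thesis
            using left_moved[of c] cb(1,2) y(2) ascent by auto
        qed
      qed
      ultimately show ?thesis
        using y(2) unfolding b_def by (intro exI[of _ "?t y"]) auto
    qed
  qed
qed

end

section \<open>Words read along frontiers\<close>

text \<open>
  The word of the frontier that separates the rows below \<open>l\<close> and the first \<open>j\<close> columns of row \<open>l\<close>, on
  its south-west side, from the other positions. From north-west to south-east it runs through the left ends of the rows above
  \<open>l\<close> (place \<open>x\<close> carries strand \<open>x\<close>; place \<open>0\<close> is a harmless extra fixed point), the tops of the first
  \<open>j\<close> positions of row \<open>l\<close>, the left side of position \<open>(l, j + 1)\<close> at place \<open>l + j\<close>, and the bottoms
  of the remaining positions of row \<open>l\<close>. Counting the left ends makes every word a permutation and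
  makes the words agree at the passage from one row to the next.
\<close>

definition word :: "position set \<Rightarrow> nat \<Rightarrow> nat \<Rightarrow> nat \<Rightarrow> nat" where
  "word D l j x =
     (if x < l then x
      else if x < l + j then below_strand D (l - 1) (x - l + 1)
      else if x = l + j then left_strand D l (j + 1)
      else below_strand D l (x - l))"

lemma left_strand_word: "left_strand D l (Suc j) = word D l j (l + j)"
  by (simp add: word_def)

lemma below_strand_word: "below_strand D l (Suc j) = word D l j (Suc (l + j))"
  by (simp add: word_def)

lemma word_Suc:
  assumes "finite D" "1 \<le> l"
  shows "word D l (Suc j) =
    (if (l, Suc j) \<in> D then word D l j \<circ> transpose (l + j) (Suc (l + j)) else word D l j)"
proof
  fix x
  consider "x < l + j" | "x = l + j" | "x = Suc (l + j)" | "Suc (l + j) < x" by linarith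
  then show "word D l (Suc j) x = (if (l, Suc j) \<in> D
      then word D l j \<circ> transpose (l + j) (Suc (l + j)) else word D l j) x"
  proof cases
    case 2
    then show ?thesis
      using assms below_strand.simps[of D "l - 1" "Suc j"] by (simp add: word_def)
  next
    case 3
    then show ?thesis
      using assms left_strand.simps[of D l "Suc (Suc j)"] by (simp add: word_def)
  qed (use assms in \<open>simp_all add: word_def transpose_def\<close>)
qed

lemma word_next_row:
  assumes "\<And>k. j < k \<Longrightarrow> (Suc l, k) \<notin> D"
  shows "word D l 0 = word D (Suc l) j"
proof
  fix x
  have below: "below_strand D l k = left_strand D (Suc l) k" if "j < k" for k
    using assms[OF that] below_strand.simps[of D l k] by simp
  have left: "left_strand D (Suc l) (Suc k) = below_strand D (Suc l) k" if "j < k" for k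
    using assms[OF that] left_strand.simps[of D "Suc l" "Suc k"] that by simp
  consider "x < l" | "x = l" | "l < x" "x \<le> l + j" | "x = Suc (l + j)" | "Suc (l + j) < x" by linarith
  then show "word D l 0 x = word D (Suc l) j x"
  proof cases
    case 2
    then show ?thesis
      using left_strand.simps[of D l 1] by (simp add: word_def)
  next
    case 3
    then have "x - Suc l + 1 = x - l" by simp
    then show ?thesis
      using 3 by (simp add: word_def)
  next
    case 4
    then show ?thesis
      using below[of "Suc j"] by (simp add: word_def)
  next
    case 5
    then have "x - l = Suc (x - Suc l)" "j < x - Suc l" by simp_all
    then show ?thesis
      using 5 below[of "x - l"] left[of "x - Suc l"] by (simp add: word_def)
  qed (simp add: word_def)
qed

lemma word_initial:
  assumes "\<And>i j. l \<le> i \<Longrightarrow> (i, j) \<notin> D"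
  shows "word D l 0 = id"
proof
  have below: "below_strand D i (Suc k) = i + Suc k" if "l \<le> i" for i k
    using that
  proof (induction k arbitrary: i)
    case 0
    then show ?case
      using assms[of "Suc i" 1] below_strand.simps[of D i 1] left_strand.simps[of D "Suc i" 1]
      by simp
  next
    case (Suc k)
    then show ?case
      using assms[of "Suc i"] below_strand.simps[of D i "Suc (Suc k)"]
        left_strand.simps[of D "Suc i" "Suc (Suc k)"]
      by simp
  qed
  show "word D l 0 x = id x" for x
  proof (cases "l < x")
    case True
    then have "x - l = Suc (x - Suc l)" by simp
    then show ?thesis
      using True below[of l "x - Suc l"] by (simp add: word_def)
  next
    case False
    then show ?thesis
      using left_strand.simps[of D l 1] by (simp add: word_def)
  qed
qed

lemma graph_bound:
  assumes "graph D"
  obtains n where "m \<le> n" "\<And>i j. (i, j) \<in> D \<Longrightarrow> 1 \<le> i \<and> i \<le> n \<and> 1 \<le> j \<and> j \<le> n"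
proof -
  let ?n = "max m (Max (insert 0 (fst ` D \<union> snd ` D)))"
  have fin: "finite (insert 0 (fst ` D \<union> snd ` D))" and pos: "D \<subseteq> {1..} \<times> {1..}"
    using assms by (auto simp: graph_def)
  have "1 \<le> i \<and> i \<le> ?n \<and> 1 \<le> j \<and> j \<le> ?n" if "(i, j) \<in> D" for i j
  proof -
    have "i \<in> insert 0 (fst ` D \<union> snd ` D)" "j \<in> insert 0 (fst ` D \<union> snd ` D)"
      using that by force+
    then have "i \<le> ?n" "j \<le> ?n"
      using Max_ge[OF fin] by (meson le_max_iff_disj)+
    then show ?thesis
      using pos that by auto
  qed
  then show ?thesis
    using that[of ?n] by simp
qed

text \<open>
  Induction over the frontiers in the order of the sweep: the rows from bottom to top, starting
  with row \<open>m\<close>, and in each row the columns from left to right. The columns beyond \<open>n\<close> of a row are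
  irrelevant for the passage to the next row.
\<close>

lemma frontier_induct [consumes 2, case_names initial step row]:
  assumes "1 \<le> l" "l \<le> m"
    and "Q m 0"
    and "\<And>l j. 1 \<le> l \<Longrightarrow> l \<le> m \<Longrightarrow> Q l j \<Longrightarrow> Q l (Suc j)"
    and "\<And>l. 1 \<le> l \<Longrightarrow> l < m \<Longrightarrow> Q (Suc l) n \<Longrightarrow> Q l 0"
  shows "Q l j"
proof -
  have row: "Q l j" if "Q l 0" "1 \<le> l" "l \<le> m" for l j
    by (induction j) (use that assms(4) in auto)
  have "1 \<le> l \<longrightarrow> Q l 0"
    using \<open>l \<le> m\<close>
  proof (induction rule: inc_induct)
    case base
    then show ?case using assms(3) by simp
  next
    case (step i)
    then show ?case using assms(5)[of i] row[of "Suc i" n] by auto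
  qed
  then show ?thesis
    using row assms(1,2) by blast
qed

lemma bij_word:
  assumes "graph D" "1 \<le> l"
  shows "bij (word D l j)"
proof -
  obtain n where n: "l \<le> n" "\<And>i j. (i, j) \<in> D \<Longrightarrow> 1 \<le> i \<and> i \<le> n \<and> 1 \<le> j \<and> j \<le> n"
    using graph_bound[OF assms(1)] by metis
  have "l \<le> Suc n"
    using n(1) by simp
  with \<open>1 \<le> l\<close> show ?thesis
  proof (induction rule: frontier_induct[where n = n])
    case initial
    have "word D (Suc n) 0 = id"
      using n(2) by (intro word_initial) force
    then show ?case by (metis bij_id)
  next
    case (step l j)
    then show ?case
      using word_Suc[of D l j] assms(1) by (auto simp: graph_def bij_comp)
  next
    case (row l)
    have "word D l 0 = word D (Suc l) n"
      using n(2) by (intro word_next_row) force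
    then show ?case using row by simp
  qed
qed

lemma word_fixed:
  assumes "graph D" "1 \<le> l"
  obtains m where "\<And>j x. m < x \<Longrightarrow> word D l j x = x"
proof -
  obtain n where n: "l \<le> n" "\<And>i j. (i, j) \<in> D \<Longrightarrow> 1 \<le> i \<and> i \<le> n \<and> 1 \<le> j \<and> j \<le> n"
    using graph_bound[OF assms(1)] by metis
  have "l \<le> Suc n"
    using n(1) by simp
  with \<open>1 \<le> l\<close> have "\<forall>x > n + n. word D l j x = x" for j
  proof (induction rule: frontier_induct[where n = n])
    case initial
    have "word D (Suc n) 0 = id"
      using n(2) by (intro word_initial) force
    then show ?case by simp
  next
    case (step l j)
    then show ?case
      using word_Suc[of D l j] assms(1) n(2)[of l "Suc j"] by (auto simp: graph_def transpose_def)
  next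
    case (row l)
    have "word D l 0 = word D (Suc l) n"
      using n(2) by (intro word_next_row) force
    then show ?case using row by simp
  qed
  then show ?thesis
    using that by blast
qed

section \<open>Reduced words and rc-graphs\<close>

text \<open>
  The intersections that the frontier has passed.
\<close>

definition swept :: "position set \<Rightarrow> nat \<Rightarrow> nat \<Rightarrow> position set" where
  "swept D l j = {(i, k) \<in> D. l < i \<or> i = l \<and> k \<le> j}"

lemma swept_Suc:
  "swept D l (Suc j) = (if (l, Suc j) \<in> D then insert (l, Suc j) (swept D l j) else swept D l j)"
  by (auto simp: swept_def le_Suc_eq)

lemma swept_row:
  assumes "\<And>i k. (i, k) \<in> D \<Longrightarrow> 1 \<le> k \<and> k \<le> n"
  shows "swept D l 0 = swept D (Suc l) n"
  using assms by (fastforce simp: swept_def)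

lemma word_cong:
  assumes "graph D" "graph E" "1 \<le> l" "swept D l j = swept E l j"
  shows "word D l j = word E l j"
proof -
  obtain m where m: "l \<le> m" "\<And>i j. (i, j) \<in> D \<Longrightarrow> 1 \<le> i \<and> i \<le> m \<and> 1 \<le> j \<and> j \<le> m"
    using graph_bound[OF assms(1)] by metis
  obtain n where n: "m \<le> n" "\<And>i j. (i, j) \<in> E \<Longrightarrow> 1 \<le> i \<and> i \<le> n \<and> 1 \<le> j \<and> j \<le> n"
    using graph_bound[OF assms(2)] by metis
  have m: "1 \<le> i \<and> i \<le> n \<and> 1 \<le> j \<and> j \<le> n" if "(i, j) \<in> D" for i j
    using m(2)[OF that] n(1) by simp
  have fin: "finite D" "finite E"
    using assms by (auto simp: graph_def)
  have "l \<le> Suc n"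
    using \<open>l \<le> m\<close> n(1) by simp
  with \<open>1 \<le> l\<close> have "swept D l j = swept E l j \<longrightarrow> word D l j = word E l j"
  proof (induction rule: frontier_induct[where n = n])
    case initial
    have "word D (Suc n) 0 = id" "word E (Suc n) 0 = id"
      using m n(2) by (intro word_initial; force)+
    then show ?case by simp
  next
    case (step l j)
    show ?case
    proof
      assume eq: "swept D l (Suc j) = swept E l (Suc j)"
      have "swept D l j = swept D l (Suc j) - {(l, Suc j)}" "swept E l j = swept E l (Suc j) - {(l, Suc j)}"
        by (auto simp: swept_def le_Suc_eq)
      moreover have "(l, Suc j) \<in> D \<longleftrightarrow> (l, Suc j) \<in> E"
        using eq unfolding swept_def by fastforce
      ultimately show "word D l (Suc j) = word E l (Suc j)"
        using eq step word_Suc[OF fin(1)] word_Suc[OF fin(2)] by simp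
    qed
  next
    case (row l)
    have "word D l 0 = word D (Suc l) n" "word E l 0 = word E (Suc l) n"
      using m n(2) by (intro word_next_row; force)+
    moreover have "swept D l 0 = swept D (Suc l) n" "swept E l 0 = swept E (Suc l) n"
      using m n(2) by (intro swept_row; force)+
    ultimately show ?case using row by simp
  qed
  then show ?thesis
    using assms(4) by simp
qed

lemma strands_cong:
  assumes "graph D" "graph E" "1 \<le> i" "1 \<le> k" "swept D i (k - 1) = swept E i (k - 1)"
  shows "left_strand D i k = left_strand E i k" "below_strand D i k = below_strand E i k"
  using word_cong[OF assms(1-3,5)] assms(4) left_strand_word[of _ i "k - 1"]
    below_strand_word[of _ i "k - 1"] by simp_all

text \<open>
  All intersections passed by the frontier act on ascents.
\<close>

definition reduced_upto :: "position set \<Rightarrow> nat \<Rightarrow> nat \<Rightarrow> bool" where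
  "reduced_upto D l j \<longleftrightarrow> (\<forall>(i, k) \<in> swept D l j. left_strand D i k < below_strand D i k)"

lemma swept_before_cong:
  assumes "swept D l j = swept E l j" "(i, k) \<in> swept D l j"
  shows "swept D i (k - 1) = swept E i (k - 1)"
proof -
  have "swept X i (k - 1) = {p \<in> swept X l j. i < fst p \<or> fst p = i \<and> snd p \<le> k - 1}"
    if "(i, k) \<in> swept X l j" for X
    using that by (auto simp: swept_def)
  from this[of D] this[of E] show ?thesis
    using assms by simp
qed

lemma reduced_upto_cong:
  assumes "graph D" "graph E" "swept D l j = swept E l j"
  shows "reduced_upto D l j \<longleftrightarrow> reduced_upto E l j"
proof -
  have "left_strand D i k = left_strand E i k \<and> below_strand D i k = below_strand E i k"
    if "(i, k) \<in> swept D l j" for i k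
  proof -
    have "1 \<le> i" "1 \<le> k"
      using that assms(1) by (auto simp: swept_def graph_def)
    then show ?thesis
      using strands_cong assms swept_before_cong[OF assms(3) that] by metis
  qed
  then show ?thesis
    using assms(3) by (fastforce simp: reduced_upto_def)
qed

lemma reduced_upto_Suc:
  "reduced_upto D l (Suc j) \<longleftrightarrow> reduced_upto D l j \<and>
     ((l, Suc j) \<in> D \<longrightarrow> word D l j (l + j) < word D l j (Suc (l + j)))"
  by (auto simp: reduced_upto_def swept_Suc left_strand_word below_strand_word)

text \<open>
  The inversions of a word, as pairs of values with the smaller one first.
\<close>

definition inversions :: "(nat \<Rightarrow> nat) \<Rightarrow> (nat \<times> nat) set" where
  "inversions w = {(s, q). s < q \<and> (\<exists>x y. x < y \<and> w x = q \<and> w y = s)}"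

lemma inversions_swap:
  assumes "bij w" "w x < w (Suc x)"
  shows "inversions (w \<circ> transpose x (Suc x)) = insert (w x, w (Suc x)) (inversions w)"
    and "(w x, w (Suc x)) \<notin> inversions w"
proof -
  have inj: "w a = w b \<longleftrightarrow> a = b" for a b
    using assms(1) by (auto dest: bij_is_inj injD)
  show "(w x, w (Suc x)) \<notin> inversions w"
    by (auto simp: inversions_def inj)
  let ?t = "transpose x (Suc x)"
  have order: "a < b \<longleftrightarrow> ?t a < ?t b" if "{a, b} \<noteq> {x, Suc x}" for a b
    using that unfolding transpose_def by auto
  show "inversions (w \<circ> ?t) = insert (w x, w (Suc x)) (inversions w)"
  proof (intro equalityI subsetI)
    fix p assume "p \<in> inversions (w \<circ> ?t)"
    then obtain a b where ab: "a < b" "p = (w (?t b), w (?t a))" "w (?t b) < w (?t a)"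
      by (auto simp: inversions_def)
    show "p \<in> insert (w x, w (Suc x)) (inversions w)"
    proof (cases "a = x \<and> b = Suc x")
      case False
      then have "?t a < ?t b"
        using order[of a b] ab(1) by (auto simp: doubleton_eq_iff)
      then show ?thesis
        using ab unfolding inversions_def by blast
    qed (use ab in simp)
  next
    fix p assume "p \<in> insert (w x, w (Suc x)) (inversions w)"
    then consider "p = (w x, w (Suc x))"
      | a b where "a < b" "p = (w b, w a)" "w b < w a"
      by (auto simp: inversions_def)
    then show "p \<in> inversions (w \<circ> ?t)"
    proof cases
      case 1
      moreover have "(w \<circ> ?t) x = w (Suc x)" "(w \<circ> ?t) (Suc x) = w x"
        by simp_all
      ultimately show ?thesis
        using assms(2) unfolding inversions_def by blast
    next
      case (2 a b)
      have "\<not> (a = x \<and> b = Suc x)"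
        using 2 assms(2) by auto
      then have "?t a < ?t b"
        using order[of a b] 2(1) by (auto simp: doubleton_eq_iff)
      moreover have "(w \<circ> ?t) (?t a) = w a" "(w \<circ> ?t) (?t b) = w b"
        by simp_all
      ultimately show ?thesis
        using 2 unfolding inversions_def by blast
    qed
  qed
qed

text \<open>
  As long as all intersections act on ascents, the pairs of strands that have crossed are exactly
  the inversions of the word, and each pair has crossed only once.
\<close>

lemma inversions_swept:
  assumes "graph D" "1 \<le> l" "reduced_upto D l j"
  shows "inversions (word D l j) = (\<lambda>(i, k). (left_strand D i k, below_strand D i k)) ` swept D l j"
    and "inj_on (\<lambda>(i, k). (left_strand D i k, below_strand D i k)) (swept D l j)"
proof -
  let ?f = "\<lambda>(i, k). (left_strand D i k, below_strand D i k)"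
  obtain n where n: "l \<le> n" "\<And>i j. (i, j) \<in> D \<Longrightarrow> 1 \<le> i \<and> i \<le> n \<and> 1 \<le> j \<and> j \<le> n"
    using graph_bound[OF assms(1)] by metis
  have fin: "finite D"
    using assms by (auto simp: graph_def)
  have "l \<le> Suc n"
    using n(1) by simp
  with \<open>1 \<le> l\<close> have "reduced_upto D l j \<longrightarrow>
      inversions (word D l j) = ?f ` swept D l j \<and> inj_on ?f (swept D l j)"
  proof (induction rule: frontier_induct[where n = n])
    case initial
    have "word D (Suc n) 0 = id"
      using n(2) by (intro word_initial) force
    moreover have "swept D (Suc n) 0 = {}"
      using n(2) by (force simp: swept_def)
    ultimately show ?case by (auto simp: inversions_def)
  next
    case (step l j)
    show ?case
    proof (cases "(l, Suc j) \<in> D")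
      case True
      show ?thesis
      proof
        assume "reduced_upto D l (Suc j)"
        then have "reduced_upto D l j" and less: "word D l j (l + j) < word D l j (Suc (l + j))"
          using True by (auto simp: reduced_upto_Suc)
        then have IH: "inversions (word D l j) = ?f ` swept D l j" "inj_on ?f (swept D l j)"
          using step by auto
        have f: "?f (l, Suc j) = (word D l j (l + j), word D l j (Suc (l + j)))"
          by (simp add: left_strand_word below_strand_word)
        have "(l, Suc j) \<notin> swept D l j"
          by (simp add: swept_def)
        then show "inversions (word D l (Suc j)) = ?f ` swept D l (Suc j) \<and> inj_on ?f (swept D l (Suc j))"
          using inversions_swap[OF bij_word[OF assms(1) step(1)] less] IH f True
          by (simp add: word_Suc[OF fin step(1)] swept_Suc)
      qed
    next
      case False
      then show ?thesis
        using step by (simp add: reduced_upto_Suc swept_Suc word_Suc[OF fin step(1)])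
    qed
  next
    case (row l)
    have "word D l 0 = word D (Suc l) n"
      using n(2) by (intro word_next_row) force
    moreover have "swept D l 0 = swept D (Suc l) n"
      using n(2) by (intro swept_row) force
    ultimately show ?case using row by (simp add: reduced_upto_def)
  qed
  then show "inversions (word D l j) = ?f ` swept D l j" "inj_on ?f (swept D l j)"
    using assms(3) by auto
qed

lemma rc_graph_if_reduced:
  assumes "graph D" and reduced: "\<And>i k. (i, k) \<in> D \<Longrightarrow> left_strand D i k < below_strand D i k"
  shows "rc_graph D"
  unfolding rc_graph_def
proof (intro conjI allI impI)
  fix s q :: nat assume "s \<noteq> q"
  let ?f = "\<lambda>(i, k). (left_strand D i k, below_strand D i k)"
  obtain n where n: "\<And>i j. (i, j) \<in> D \<Longrightarrow> 1 \<le> i \<and> i \<le> n \<and> 1 \<le> j \<and> j \<le> n"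
    using graph_bound[OF assms(1), of 0] by metis
  have "swept D 1 n = D"
    using n by (force simp: swept_def)
  then have inj: "inj_on ?f D"
    using inversions_swept(2)[of D 1 n] assms by (auto simp: reduced_upto_def)
  have f: "?f p = (min s q, max s q)" if "p \<in> crossings D s q" for p
    using that reduced[of "fst p" "snd p"]
    by (auto simp: crossings_def doubleton_eq_iff min_def max_def)
  have sub: "crossings D s q \<subseteq> D"
    by (auto simp: crossings_def)
  have "p = p'" if "p \<in> crossings D s q" "p' \<in> crossings D s q" for p p'
  proof (rule inj_onD[OF inj])
    show "?f p = ?f p'"
      using f[OF that(1)] f[OF that(2)] by simp
  qed (use that sub in auto)
  moreover have "finite (crossings D s q)"
    using sub assms(1) finite_subset by (auto simp: graph_def)
  ultimately show "card (crossings D s q) \<le> 1"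
    using card_le_Suc0_iff_eq by (metis One_nat_def)
qed (rule assms(1))

lemma rc_graph_reduced:
  assumes "rc_graph D" "1 \<le> l"
  shows "reduced_upto D l j"
proof -
  have graph: "graph D" and fin: "finite D"
    using assms by (auto simp: rc_graph_def graph_def)
  obtain n where n: "l \<le> n" "\<And>i j. (i, j) \<in> D \<Longrightarrow> 1 \<le> i \<and> i \<le> n \<and> 1 \<le> j \<and> j \<le> n"
    using graph_bound[OF graph] by metis
  have "l \<le> Suc n"
    using n(1) by simp
  with \<open>1 \<le> l\<close> show ?thesis
  proof (induction rule: frontier_induct[where n = n])
    case initial
    have "swept D (Suc n) 0 = {}"
      using n(2) by (force simp: swept_def)
    then show ?case by (simp add: reduced_upto_def)
  next
    case (step l j)
    let ?w = "word D l j"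
    \<comment> \<open>An intersection at a descent joins two strands that form an inversion and so have already
      crossed.\<close>
    have "?w (l + j) < ?w (Suc (l + j))" if D: "(l, Suc j) \<in> D"
    proof (rule ccontr)
      assume "\<not> ?thesis"
      moreover have ne: "?w (l + j) \<noteq> ?w (Suc (l + j))"
        using bij_word[OF graph step(1), of j] by (metis bij_is_inj injD n_not_Suc_n)
      ultimately have "(?w (Suc (l + j)), ?w (l + j)) \<in> inversions ?w"
        unfolding inversions_def by auto
      then obtain i k where ik: "(i, k) \<in> swept D l j"
        "left_strand D i k = ?w (Suc (l + j))" "below_strand D i k = ?w (l + j)"
        using inversions_swept(1)[OF graph step(1,3)] by auto
      let ?X = "crossings D (?w (l + j)) (?w (Suc (l + j)))"
      have "(i, k) \<in> ?X" "(l, Suc j) \<in> ?X" "(i, k) \<noteq> (l, Suc j)"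
        using ik D by (auto simp: crossings_def swept_def left_strand_word below_strand_word)
      moreover have "finite ?X"
        using fin finite_subset[of ?X D] by (auto simp: crossings_def)
      moreover have "card ?X \<le> Suc 0"
        using assms(1) ne by (simp add: rc_graph_def)
      ultimately show False
        by (simp add: card_le_Suc0_iff_eq) blast
    qed
    then show ?case
      using step by (simp add: reduced_upto_Suc)
  next
    case (row l)
    have "swept D l 0 = swept D (Suc l) n"
      using n(2) by (intro swept_row) force
    then show ?case using row by (simp add: reduced_upto_def)
  qed
qed

section \<open>Adding an intersection to a row\<close>

text \<open>
  To the right of a new intersection the two strands that meet there exchange their names.
\<close>

lemma word_insert:
  assumes "graph E" "1 \<le> l" "(l, Suc k) \<notin> E" "Suc k \<le> j"
  shows "word (insert (l, Suc k) E) l j =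
    transpose (left_strand E l (Suc k)) (below_strand E l (Suc k)) \<circ> word E l j"
  using assms(4)
proof (induction rule: dec_induct)
  let ?E = "insert (l, Suc k) E"
  have graph: "graph ?E"
    using assms by (auto simp: graph_def)
  have fin: "finite ?E" "finite E"
    using assms by (auto simp: graph_def)
  {
    case base
    have "swept ?E l k = swept E l k"
      by (auto simp: swept_def)
    then have "word ?E l k = word E l k"
      using word_cong[OF graph assms(1,2)] by simp
    moreover have "inj (word E l k)"
      using bij_word[OF assms(1,2)] by (rule bij_is_inj)
    ultimately show ?case
      using word_Suc[OF fin(1) assms(2), of k] word_Suc[OF fin(2) assms(2), of k] assms(3)
      by (auto simp: left_strand_word below_strand_word fun_eq_iff transpose_def inj_eq)
  next
    case (step j)
    have "(l, Suc j) \<in> ?E \<longleftrightarrow> (l, Suc j) \<in> E"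
      using step by simp
    then show ?case
      using step word_Suc[OF fin(1) assms(2), of j] word_Suc[OF fin(2) assms(2), of j]
      by (simp add: fun_eq_iff)
  }
qed

text \<open>
  A touching point \<open>(l, k + 1)\<close> seen from a later frontier of the same row: the strand from the left
  has left through the top, at place \<open>l + k\<close>, while the strand \<open>q\<close> from below has run to the right,
  crossing only larger strands since the row is reduced, until it turned up or reached the frontier.
\<close>

lemma follow_row:
  assumes "graph E" "1 \<le> l" "(l, Suc k) \<notin> E" "Suc k \<le> j" "reduced_upto E l j"
  obtains y where "l + k < y" "y \<le> l + j"
    "word E l j (l + k) = left_strand E l (Suc k)" "word E l j y = below_strand E l (Suc k)"
    "\<And>z. l + k < z \<Longrightarrow> z < y \<Longrightarrow> word E l j y < word E l j z"
proof -
  have fin: "finite E"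
    using assms by (auto simp: graph_def)
  let ?q = "below_strand E l (Suc k)"
  have "reduced_upto E l j \<longrightarrow> (\<exists>y. l + k < y \<and> y \<le> l + j \<and>
    word E l j (l + k) = left_strand E l (Suc k) \<and> word E l j y = ?q \<and>
    (\<forall>z. l + k < z \<longrightarrow> z < y \<longrightarrow> ?q < word E l j z))"
    using assms(4)
  proof (induction rule: dec_induct)
    case base
    then show ?case
      using assms(3) word_Suc[OF fin assms(2), of k]
      by (auto simp: left_strand_word below_strand_word intro!: exI[of _ "Suc (l + k)"])
  next
    case (step j)
    show ?case
    proof
      assume red: "reduced_upto E l (Suc j)"
      then obtain y where y: "l + k < y" "y \<le> l + j"
        "word E l j (l + k) = left_strand E l (Suc k)" "word E l j y = ?q"
        "\<And>z. l + k < z \<Longrightarrow> z < y \<Longrightarrow> ?q < word E l j z"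
        using step by (auto simp: reduced_upto_Suc)
      show "\<exists>y. l + k < y \<and> y \<le> l + Suc j \<and>
        word E l (Suc j) (l + k) = left_strand E l (Suc k) \<and> word E l (Suc j) y = ?q \<and>
        (\<forall>z. l + k < z \<longrightarrow> z < y \<longrightarrow> ?q < word E l (Suc j) z)"
      proof (cases "(l, Suc j) \<in> E")
        case False
        then have "word E l (Suc j) = word E l j"
          using word_Suc[OF fin assms(2)] by simp
        then show ?thesis
          using y by (intro exI[of _ y]) auto
      next
        case True
        define w where "w = word E l (Suc j)"
        have w: "w (l + j) = word E l j (Suc (l + j))" "w (Suc (l + j)) = word E l j (l + j)"
          "\<And>z. z < l + j \<Longrightarrow> w z = word E l j z"
          using True word_Suc[OF fin assms(2), of j] unfolding w_def by (auto simp: transpose_def)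
        have less: "word E l j (l + j) < word E l j (Suc (l + j))"
          using red True by (simp add: reduced_upto_Suc)
        have first: "w (l + k) = left_strand E l (Suc k)"
          using w(3)[of "l + k"] y(3) step by simp
        show ?thesis
        proof (cases "y = l + j")
          case y': True
          have "?q < w z" if "l + k < z" "z < Suc (l + j)" for z
          proof (cases "z = l + j")
            case True
            then show ?thesis using w(1) less y(4) y' by simp
          next
            case False
            then show ?thesis using w(3)[of z] y(5)[of z] that y' by simp
          qed
          then show ?thesis
            using first w(2) y(1,4) y' unfolding w_def by (intro exI[of _ "Suc (l + j)"]) auto
        next
          case False
          then have "y < l + j" using y(2) by simp
          then have "?q < w z" if "l + k < z" "z < y" for z
            using w(3)[of z] y(5)[of z] that by simp
          then show ?thesis
            using first w(3)[OF \<open>y < l + j\<close>] y(1,4) \<open>y < l + j\<close> unfolding w_def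
            by (intro exI[of _ y]) auto
        qed
      qed
    qed
  qed
  then show ?thesis
    using that assms(5) by auto
qed

lemma reduced_insert:
  assumes "graph E" "1 \<le> l" "(l, Suc k) \<notin> E" "Suc k \<le> j" "reduced_upto E l j"
    and less: "left_strand E l (Suc k) < below_strand E l (Suc k)"
  shows "reduced_upto (insert (l, Suc k) E) l j"
  using assms(4,5)
proof (induction rule: dec_induct)
  let ?E = "insert (l, Suc k) E"
  let ?s = "left_strand E l (Suc k)" and ?q = "below_strand E l (Suc k)"
  have graph: "graph ?E"
    using assms by (auto simp: graph_def)
  {
    case base
    have "swept ?E l k = swept E l k"
      by (auto simp: swept_def)
    then have "word ?E l k = word E l k" "reduced_upto ?E l k \<longleftrightarrow> reduced_upto E l k"
      using word_cong[OF graph assms(1,2)] reduced_upto_cong[OF graph assms(1)] by simp_all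
    then show ?case
      using base less by (simp add: reduced_upto_Suc left_strand_word below_strand_word)
  next
    case (step j)
    let ?w = "word E l j"
    have red: "reduced_upto E l j"
      using step by (simp add: reduced_upto_Suc)
    have "word ?E l j (l + j) < word ?E l j (Suc (l + j))" if "(l, Suc j) \<in> ?E"
    proof -
      have less_j: "?w (l + j) < ?w (Suc (l + j))"
        using that step by (simp add: reduced_upto_Suc)
      have inj: "?w x = ?w y \<longleftrightarrow> x = y" for x y
        using bij_word[OF assms(1,2)] by (auto dest: bij_is_inj injD)
      obtain y where y: "l + k < y" "y \<le> l + j" "?w (l + k) = ?s" "?w y = ?q"
        using follow_row[OF assms(1,2,3) step(1) red] by metis
      have "?w (l + j) \<noteq> ?s" "?w (Suc (l + j)) \<noteq> ?s" "?w (Suc (l + j)) \<noteq> ?q"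
        using y step(1) inj by (metis Suc_n_not_le_n add_le_cancel_left le_SucI)+
      then show ?thesis
        using word_insert[OF assms(1,2,3) step(1)] less_j less
        by (auto simp: transpose_def)
    qed
    then show ?case
      using step red by (simp add: reduced_upto_Suc)
  }
qed

section \<open>The invariant of the algorithm\<close>

text \<open>
  The state of the algorithm when row \<open>l\<close> has been treated up to column \<open>c\<close>: beyond the frontier the
  graph is still the original one, up to the frontier it is reduced, and the two words are linked by
  the pairs of the current sequence.
\<close>

fun frontier_inv :: "nat \<Rightarrow> position set \<Rightarrow> nat \<Rightarrow> nat \<Rightarrow> state \<Rightarrow> bool" where
  "frontier_inv r D l c (E, ps) \<longleftrightarrow>
     graph E \<and> (\<forall>i k. i < l \<or> i = l \<and> c < k \<longrightarrow> ((i, k) \<in> E \<longleftrightarrow> (i, k) \<in> D)) \<and>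
     reduced_upto E l c \<and> linked_words r (set ps) (word D l c) (word E l c)"

lemma frontier_inv_keep:
  assumes "rc_graph D" "1 \<le> l" and inv: "frontier_inv r D l c st"
    and keep: "\<not> removable st (l, Suc c)"
  shows "frontier_inv r D l (Suc c) st"
proof -
  obtain E ps where st: "st = (E, ps)" by force
  have graph: "graph E" and same: "\<And>i k. i < l \<or> i = l \<and> c < k \<Longrightarrow> (i, k) \<in> E \<longleftrightarrow> (i, k) \<in> D"
    and red: "reduced_upto E l c" and linked: "linked_words r (set ps) (word D l c) (word E l c)"
    using inv by (auto simp: st)
  have fin: "finite E" "finite D"
    using assms graph by (auto simp: rc_graph_def graph_def)
  interpret linked_words r "set ps" "word D l c" "word E l c"
    by (rule linked)
  show ?thesis
  proof (cases "(l, Suc c) \<in> D")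
    case False
    then show ?thesis
      using graph same red linked word_Suc[OF fin(1) assms(2), of c] word_Suc[OF fin(2) assms(2), of c]
      by (simp add: st reduced_upto_Suc)
  next
    case True
    then have E: "(l, Suc c) \<in> E"
      using same by simp
    have ascent: "word D l c (l + c) < word D l c (Suc (l + c))"
      using rc_graph_reduced[OF assms(1,2), of "Suc c"] True by (simp add: reduced_upto_Suc)
    have "root (set ps) (word E l c (Suc (l + c))) \<noteq> a" if a: "(a, word E l c (l + c)) \<in> set ps" for a
    proof
      assume "root (set ps) (word E l c (Suc (l + c))) = a"
      then have "(a, word E l c (Suc (l + c))) \<in> set ps \<or> word E l c (Suc (l + c)) = a"
        by (auto simp: root_eq_iff)
      then show False
        using keep E a unfolding st by (fastforce simp: left_strand_word below_strand_word)
    qed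
    note * = keep_crossing[OF ascent this]
    show ?thesis
      using graph same red * True E
        word_Suc[OF fin(1) assms(2), of c] word_Suc[OF fin(2) assms(2), of c]
      by (simp add: st reduced_upto_Suc)
  qed
qed

lemma frontier_inv_advance:
  assumes "rc_graph D" "1 \<le> l" "frontier_inv r D l c st" "c \<le> d"
    and "\<And>k. c < k \<Longrightarrow> k \<le> d \<Longrightarrow> \<not> removable st (l, k)"
  shows "frontier_inv r D l d st"
  using assms(4,5)
proof (induction rule: dec_induct)
  case base
  show ?case by (rule assms(3))
next
  case (step d)
  then show ?case
    using frontier_inv_keep[OF assms(1,2)] by simp
qed

lemma frontier_inv_remove:
  assumes "rc_graph D" "1 \<le> l" and inv: "frontier_inv r D l c (E, ps)"
    and rem: "removable (E, ps) (l, Suc c)"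
    and new: "remove_intersection (l, Suc c) (E, ps) = (E', ps')"
  shows "frontier_inv r D l (Suc c) (E', ps')"
    and "r < left_strand E' l (Suc c)" "left_strand E' l (Suc c) \<notin> snd ` set ps'"
proof -
  have graph: "graph E" and same: "\<And>i k. i < l \<or> i = l \<and> c < k \<Longrightarrow> (i, k) \<in> E \<longleftrightarrow> (i, k) \<in> D"
    and red: "reduced_upto E l c" and linked: "linked_words r (set ps) (word D l c) (word E l c)"
    using inv by auto
  interpret linked_words r "set ps" "word D l c" "word E l c"
    by (rule linked)
  let ?b = "word E l c (l + c)"
  have E': "E' = E - {(l, Suc c)}" and ps': "ps' = filter (\<lambda>(a, b). b \<noteq> ?b) ps"
    using new by (auto simp: left_strand_word)
  have graph': "graph E'"
    using graph by (auto simp: graph_def E')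
  have fin: "finite E'" "finite D"
    using assms graph' by (auto simp: rc_graph_def graph_def)
  obtain a where a: "(a, ?b) \<in> set ps" "root (set ps) (word E l c (Suc (l + c))) = a"
    and mem: "(l, Suc c) \<in> E"
    using rem root_pair root_small pair_le by (fastforce simp: left_strand_word below_strand_word)
  have D: "(l, Suc c) \<in> D"
    using same mem by simp
  have ascent: "word D l c (l + c) < word D l c (Suc (l + c))"
    using rc_graph_reduced[OF assms(1,2), of "Suc c"] D by (simp add: reduced_upto_Suc)
  have set: "set ps' = set ps - {(a, ?b)}"
    using a(1) pair_unique unfolding ps' by auto
  have "swept E' l c = swept E l c"
    by (auto simp: swept_def E')
  then have w: "word E' l c = word E l c" and red': "reduced_upto E' l c"
    using word_cong[OF graph' graph assms(2)] reduced_upto_cong[OF graph' graph] red by simp_all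
  show "frontier_inv r D l (Suc c) (E', ps')"
    using graph' same red' remove_link(2)[OF a ascent] D mem w set
      word_Suc[OF fin(1) assms(2), of c] word_Suc[OF fin(2) assms(2), of c]
    by (auto simp: reduced_upto_Suc E')
  show "r < left_strand E' l (Suc c)"
    using pair_gt[OF a(1)] w by (simp add: left_strand_word)
  show "left_strand E' l (Suc c) \<notin> snd ` set ps'"
    using w by (auto simp: left_strand_word ps')
qed

lemma set_insert_rightmost: "set (insert_rightmost s q ps) = insert (s, q) (set ps)"
proof -
  have "set ps = set (takeWhile (\<lambda>(a, b). a \<le> s) ps) \<union> set (dropWhile (\<lambda>(a, b). a \<le> s) ps)"
    by (metis set_append takeWhile_dropWhile_id)
  then show ?thesis
    by (auto simp: insert_rightmost_def)
qed

lemma set_insert_before: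
  assumes "(a, s) \<in> set ps" "\<And>c. (c, s) \<in> set ps \<Longrightarrow> c = a"
  shows "set (insert_before s q ps) = insert (a, q) (set ps)"
  using assms
proof (induction ps)
  case (Cons p ps)
  obtain c b where p: "p = (c, b)" by force
  show ?case
  proof (cases "b = s")
    case True
    then have "c = a"
      using Cons.prems(2)[of c] p by simp
    then show ?thesis
      using True p by auto
  next
    case False
    have "(a, s) \<in> set ps"
      using Cons.prems(1) False p by simp
    then have "set (insert_before s q ps) = insert (a, q) (set ps)"
      by (rule Cons.IH) (rule Cons.prems(2), simp)
    then show ?thesis
      using False p by auto
  qed
qed simp

lemma frontier_inv_add:
  assumes "1 \<le> l" and inv: "frontier_inv r D l c st"
    and ins: "insertable r st (l, k)" and "k \<le> c"
  shows "frontier_inv r D l c (add_intersection r (l, k) st)"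
proof -
  obtain E ps where st: "st = (E, ps)" by force
  have graph: "graph E" and same: "\<And>i k. i < l \<or> i = l \<and> c < k \<Longrightarrow> (i, k) \<in> E \<longleftrightarrow> (i, k) \<in> D"
    and red: "reduced_upto E l c" and linked: "linked_words r (set ps) (word D l c) (word E l c)"
    using inv by (auto simp: st)
  obtain m where k: "k = Suc m"
    using ins not0_implies_Suc by (fastforce simp: st)
  interpret linked_words r "set ps" "word D l c" "word E l c"
    by (rule linked)
  let ?s = "left_strand E l (Suc m)" and ?q = "below_strand E l (Suc m)"
  have new: "(l, Suc m) \<notin> E" and s: "?s \<le> r \<or> ?s \<in> snd ` set ps" and q: "r < ?q" "?q \<notin> snd ` set ps"
    using ins unfolding st k by (auto simp: Let_def)
  have "Suc m \<le> c"
    using assms(4) k by simp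
  note row = assms(1) new this
  obtain y where y: "l + m < y" "word E l c (l + m) = ?s" "word E l c y = ?q"
    "\<And>z. l + m < z \<Longrightarrow> z < y \<Longrightarrow> word E l c y < word E l c z"
    using follow_row[OF graph row red] by metis
  have less: "?s < ?q"
    and linked': "linked_words r (insert (root (set ps) ?s, ?q) (set ps))
      (word D l c) (word E l c \<circ> transpose (l + m) y)"
    using insert_link[of "l + m" y] y s q by auto
  have "word (insert (l, Suc m) E) l c = word E l c \<circ> transpose (l + m) y"
  proof
    fix x
    have w: "word (insert (l, Suc m) E) l c x = transpose ?s ?q (word E l c x)"
      using word_insert[OF graph row] by simp
    consider "x = l + m" | "x = y" | "x \<noteq> l + m" "x \<noteq> y" by blast
    then show "word (insert (l, Suc m) E) l c x = (word E l c \<circ> transpose (l + m) y) x"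
    proof cases
      case 3
      then have "word E l c x \<noteq> ?s" "word E l c x \<noteq> ?q"
        using y(2,3) inj_words(2) by metis+
      then show ?thesis using w 3 by simp
    qed (use w y(2,3) in simp_all)
  qed
  moreover have "set (if ?s \<le> r then insert_rightmost ?s ?q ps else insert_before ?s ?q ps) =
      insert (root (set ps) ?s, ?q) (set ps)"
  proof (cases "?s \<le> r")
    case True
    then show ?thesis
      using root_small by (simp add: set_insert_rightmost)
  next
    case False
    then obtain a where a: "(a, ?s) \<in> set ps"
      using s by auto
    then have "set (insert_before ?s ?q ps) = insert (a, ?q) (set ps)"
      using pair_unique by (intro set_insert_before) blast+
    then show ?thesis
      using False root_pair[OF a] by simp
  qed
  moreover have "graph (insert (l, Suc m) E)"
    using graph assms(1) by (auto simp: graph_def)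
  moreover have "reduced_upto (insert (l, Suc m) E) l c"
    using reduced_insert[OF graph row red less] .
  ultimately show ?thesis
    using same linked' \<open>Suc m \<le> c\<close> unfolding st k by (auto simp: Let_def)
qed

section \<open>Termination and correctness of the algorithm\<close>

text \<open>
  Without an insertable position to the left of column \<open>j\<close>, the property of being at most \<open>r\<close> or
  paired passes from strand \<open>l\<close> to each strand that enters a position of row \<open>l\<close> up to column \<open>j\<close>
  from the left.
\<close>

lemma insertable_exists:
  assumes "1 \<le> l" "l \<le> r" "1 \<le> j"
    and left: "r < left_strand E l j" "left_strand E l j \<notin> snd ` set ps"
  shows "\<exists>k<j. insertable r (E, ps) (l, k)"
proof (rule ccontr)
  assume none: "\<not> ?thesis"
  have "left_strand E l j \<le> r \<or> left_strand E l j \<in> snd ` set ps"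
    using \<open>1 \<le> j\<close>
  proof (induction rule: dec_induct)
    case base
    show ?case
      using \<open>l \<le> r\<close> left_strand.simps[of E l 1] by simp
  next
    case (step k)
    have "\<not> insertable r (E, ps) (l, k)"
      using none step by blast
    then show ?case
      using step \<open>1 \<le> l\<close> left_strand.simps[of E l "Suc k"] by (auto simp: Let_def)
  qed
  then show False
    using left by simp
qed

lemma left_strand_large:
  assumes "graph E" "1 \<le> l" "finite B"
  obtains m where "\<And>j. m < j \<Longrightarrow> r < left_strand E l j \<and> left_strand E l j \<notin> B"
proof -
  obtain m where m: "\<And>j x. m < x \<Longrightarrow> word E l j x = x"
    using word_fixed[OF assms(1,2)] by metis
  \<comment> \<open>Far to the right the strand entering column \<open>k + 1\<close> from the left is \<open>l + k\<close>.\<close>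
  define n where "n = Max (insert m (insert r B))"
  have n: "x \<le> n" if "x \<in> insert m (insert r B)" for x
    unfolding n_def using that assms(3) by (intro Max_ge) auto
  have "r < left_strand E l j \<and> left_strand E l j \<notin> B" if j: "n < j" for j
  proof -
    obtain k where k: "j = Suc k"
      using j by (cases j) auto
    have large: "n < l + k"
      using j k assms(2) by simp
    then have "left_strand E l j = l + k"
      using m[of "l + k" k] n[of m] k by (simp add: left_strand_word)
    then show ?thesis
      using large n[of r] n[of "l + k"] by auto
  qed
  then show ?thesis
    using that by blast
qed

lemma insert_elements_inv:
  assumes "1 \<le> l" "l \<le> r" "\<And>n. m \<le> n \<Longrightarrow> frontier_inv r D l n st"
  shows "\<exists>st' m'. insert_elements r l k st = Some st' \<and> (\<forall>n\<ge>m'. frontier_inv r D l n st')"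
  using assms(3)
proof (induction k arbitrary: st m)
  case 0
  then show ?case by auto
next
  case (Suc k)
  obtain E ps where st: "st = (E, ps)" by force
  have "graph E"
    using Suc.prems[of m] st by simp
  then obtain b where b: "\<And>j. b < j \<Longrightarrow> r < left_strand E l j \<and> left_strand E l j \<notin> snd ` set ps"
    using left_strand_large[of E l "snd ` set ps" r] \<open>1 \<le> l\<close> by auto
  define J where "J = {j \<in> UNIV. insertable r st (l, j)}"
  \<comment> \<open>Only finitely many positions of the row are insertable, so that there is a rightmost one.\<close>
  have "j \<le> b" if "j \<in> J" for j
    using that b[of j] unfolding J_def st by (force simp: Let_def)
  then have fin: "finite J"
    by (meson finite_atMost finite_subset atMost_iff subsetI)
  have "J \<noteq> {}"
    using insertable_exists[of l r "Suc b" E ps] b[of "Suc b"] assms(1,2) unfolding J_def st by auto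
  then have ins: "insertable r st (l, Max J)"
    using Max_in[OF fin] unfolding J_def by auto
  define st1 where "st1 = add_intersection r (l, Max J) st"
  have add: "add_in_row r l UNIV st = Some st1"
    using fin \<open>J \<noteq> {}\<close> unfolding add_in_row_def J_def st1_def Let_def by simp
  have "frontier_inv r D l n st1" if "max m (Max J) \<le> n" for n
    unfolding st1_def using frontier_inv_add[OF assms(1) Suc.prems ins] that by simp
  then obtain st' m' where "insert_elements r l k st1 = Some st'" "\<forall>n\<ge>m'. frontier_inv r D l n st'"
    using Suc.IH by blast
  then show ?case
    using add by auto
qed

text \<open>
  Rectification beyond column \<open>c\<close> terminates because beyond the frontier the current graph has the
  intersections of \<open>D\<close> only, so that every removable one lies in a column occupied by \<open>D\<close>.
\<close>

lemma rectify_from_inv: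
  assumes "rc_graph D" "1 \<le> l" "l \<le> r" "frontier_inv r D l c st"
  shows "\<exists>st' m. rectify_from r l c st = Some st' \<and> (\<forall>n\<ge>m. frontier_inv r D l n st')"
proof -
  have "graph D"
    using assms(1) by (simp add: rc_graph_def)
  then obtain d where d: "\<And>j. (l, j) \<in> D \<Longrightarrow> j \<le> d"
    using graph_bound[of D 0] by metis
  show ?thesis
    using assms(4)
  proof (induction "d - c" arbitrary: c st rule: less_induct)
    case less
    show ?case
    proof (cases "\<exists>j>c. removable st (l, j)")
      case False
      then have "rectify_from r l c st = Some st"
        by (subst rectify_from.simps) (simp only: if_False)
      moreover have "frontier_inv r D l n st" if "c \<le> n" for n
        using frontier_inv_advance[OF assms(1,2) less.prems that] False by auto
      ultimately show ?thesis by blast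
    next
      case True
      define j where "j = (LEAST j. c < j \<and> removable st (l, j))"
      have j: "c < j" "removable st (l, j)"
        using LeastI_ex[OF True] unfolding j_def by auto
      have first: "\<not> removable st (l, k)" if "c < k" "k < j" for k
        using not_less_Least[of k "\<lambda>j. c < j \<and> removable st (l, j)"] that unfolding j_def by auto
      obtain e where e: "j = Suc e"
        using j(1) by (cases j) auto
      have before: "frontier_inv r D l e st"
        using frontier_inv_advance[OF assms(1,2) less.prems, of e] first j(1) e by auto
      obtain E ps where st: "st = (E, ps)" by force
      obtain E' ps' where st': "remove_intersection (l, j) st = (E', ps')"
        by (metis surj_pair)
      have after: "frontier_inv r D l j (E', ps')" "r < left_strand E' l j"
          "left_strand E' l j \<notin> snd ` set ps'"
        using frontier_inv_remove[of D l r e E ps E' ps'] assms(1,2) before j(2) st' unfolding st e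
        by blast+
      define J where "J = {k \<in> {..<j}. insertable r (E', ps') (l, k)}"
      have fin: "finite J"
        unfolding J_def by simp
      have "J \<noteq> {}"
        using insertable_exists[OF assms(2,3) _ after(2,3)] e unfolding J_def by auto
      then have "Max J \<in> J"
        using fin by simp
      moreover have "k \<in> J \<longleftrightarrow> k < j \<and> insertable r (E', ps') (l, k)" for k
        by (simp only: J_def mem_Collect_eq lessThan_iff)
      ultimately have ins: "insertable r (E', ps') (l, Max J)" "Max J < j"
        by blast+
      define st1 where "st1 = add_intersection r (l, Max J) (E', ps')"
      have add: "add_in_row r l {..<j} (E', ps') = Some st1"
        using fin \<open>J \<noteq> {}\<close> unfolding add_in_row_def J_def st1_def Let_def by simp
      have inv1: "frontier_inv r D l j st1"
        unfolding st1_def using frontier_inv_add[OF assms(2) after(1) ins(1)] ins(2) by simp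
      have "(l, j) \<in> E"
        using j(2) unfolding st by simp
      then have "(l, j) \<in> D"
        using less.prems j(1) unfolding st by simp
      then have "d - j < d - c"
        using d[of j] j(1) by simp
      then have "\<exists>st' m. rectify_from r l j st1 = Some st' \<and> (\<forall>n\<ge>m. frontier_inv r D l n st')"
        using less.hyps inv1 by blast
      moreover have "rectify_from r l c st = rectify_from r l j st1"
        by (subst rectify_from.simps)
          (simp only: True if_True Let_def j_def[symmetric] st' add, simp)
      ultimately show ?thesis by simp
    qed
  qed
qed

lemma frontier_inv_next_row:
  assumes "graph D" "\<And>n. m \<le> n \<Longrightarrow> frontier_inv r D (Suc l) n st"
  shows "frontier_inv r D l 0 st"
proof -
  obtain E ps where st: "st = (E, ps)" by force
  have "graph E"
    using assms(2)[of m] st by simp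
  obtain d where d: "m \<le> d" "\<And>i j. (i, j) \<in> D \<Longrightarrow> 1 \<le> i \<and> i \<le> d \<and> 1 \<le> j \<and> j \<le> d"
    using graph_bound[OF assms(1)] by metis
  obtain e where e: "d \<le> e" "\<And>i j. (i, j) \<in> E \<Longrightarrow> 1 \<le> i \<and> i \<le> e \<and> 1 \<le> j \<and> j \<le> e"
    using graph_bound[OF \<open>graph E\<close>] by metis
  have "word D l 0 = word D (Suc l) e" "word E l 0 = word E (Suc l) e"
    using d(2) e by (intro word_next_row; fastforce)+
  moreover have "swept E l 0 = swept E (Suc l) e"
    using e by (intro swept_row) auto
  moreover have "frontier_inv r D (Suc l) e st"
    using assms(2) d(1) e(1) by simp
  ultimately show ?thesis
    unfolding st by (auto simp: reduced_upto_def)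
qed

lemma process_rows_rc:
  assumes "rc_graph D" "n \<le> r" "\<And>c. m \<le> c \<Longrightarrow> frontier_inv r D (Suc n) c st"
  shows "\<exists>st'. process_rows r ins n st = Some st' \<and> rc_graph (fst st')"
  using assms(2,3)
proof (induction n arbitrary: st m)
  case 0
  obtain E ps where st: "st = (E, ps)" by force
  have "graph E"
    using 0(2)[of m] st by simp
  then obtain e where e: "m \<le> e" "\<And>i j. (i, j) \<in> E \<Longrightarrow> 1 \<le> i \<and> i \<le> e \<and> 1 \<le> j \<and> j \<le> e"
    using graph_bound by metis
  have "reduced_upto E (Suc 0) e"
    using 0(2)[of e] e(1) st by simp
  moreover have "swept E (Suc 0) e = E"
    using e(2) by (force simp: swept_def)
  ultimately have "rc_graph E"
    using rc_graph_if_reduced[OF \<open>graph E\<close>] by (auto simp: reduced_upto_def)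
  then show ?case
    using st by simp
next
  case (Suc n)
  have "graph D"
    using assms(1) by (simp add: rc_graph_def)
  then have "frontier_inv r D (Suc n) 0 st"
    using frontier_inv_next_row[OF _ Suc.prems(2)] by blast
  then obtain st1 m1 where rect: "rectify r (Suc n) st = Some st1"
    and inv1: "\<And>c. m1 \<le> c \<Longrightarrow> frontier_inv r D (Suc n) c st1"
    using rectify_from_inv[OF assms(1) _ Suc.prems(1), of 0 st] unfolding rectify_def
    by (metis le_add1 plus_1_eq_Suc)
  obtain st2 m2 where ins: "(case map_of ins (Suc n) of None \<Rightarrow> Some st1
      | Some k \<Rightarrow> insert_elements r (Suc n) k st1) = Some st2"
    and inv2: "\<And>c. m2 \<le> c \<Longrightarrow> frontier_inv r D (Suc n) c st2"
  proof (cases "map_of ins (Suc n)")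
    case None
    then show ?thesis
      using inv1 by (intro that[of st1 m1]) (simp, blast)
  next
    case (Some k)
    obtain st2 m2 where "insert_elements r (Suc n) k st1 = Some st2"
      "\<forall>c\<ge>m2. frontier_inv r D (Suc n) c st2"
      using insert_elements_inv[of "Suc n" r m1 D st1 k] Suc.prems(1) inv1 by (metis le_add1 plus_1_eq_Suc)
    with Some show ?thesis
      by (intro that[of st2 m2]) (simp, blast)
  qed
  have "\<exists>st'. process_rows r ins n st2 = Some st' \<and> rc_graph (fst st')"
    using Suc.IH[of m2 st2] Suc.prems(1) inv2 by simp
  then show ?case
    using rect ins by simp
qed

lemma frontier_inv_start:
  assumes "rc_graph D" "1 \<le> l"
  shows "frontier_inv r D l c (D, [])"
proof -
  have "graph D"
    using assms(1) by (simp add: rc_graph_def)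
  then have "linked_words r {} (word D l c) (word D l c)"
    using assms(2) by unfold_locales (auto simp: bij_word)
  then show ?thesis
    using \<open>graph D\<close> rc_graph_reduced[OF assms] by simp
qed

theorem theorem3p1:
  fixes D :: "(nat \<times> nat) set" and r :: nat and ins :: "(nat \<times> nat) list"
  assumes "rc_graph D"
    and "1 \<le> r"
    and "ins \<noteq> []"
    and "sorted_wrt (>) (map fst ins)"
    and "\<forall>(i, k) \<in> set ins. 1 \<le> i \<and> i \<le> r \<and> 1 \<le> k"
  shows "\<exists>E. row_insertion r ins D = Some E \<and> rc_graph E"
proof -
  obtain i k ins' where ins: "ins = (i, k) # ins'"
    using assms(3) by (metis list.exhaust surj_pair)
  then have i: "1 \<le> i" "i \<le> r"
    using assms(5) by auto
  obtain st m where first: "insert_elements r i k (D, []) = Some st"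
    and inv: "\<And>c. m \<le> c \<Longrightarrow> frontier_inv r D i c st"
    using insert_elements_inv[of i r 0 D "(D, [])" k] frontier_inv_start[OF assms(1)] i by blast
  have "\<exists>st'. process_rows r ins' (i - 1) st = Some st' \<and> rc_graph (fst st')"
    using process_rows_rc[OF assms(1), of "i - 1" r m st] inv i by simp
  then show ?thesis
    using first ins by auto
qed

end
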